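(* (i) Let $p\in[0,\tfrac12]^{\mathbb N}_{\downarrow 0}$. Then $\Delta_n(p)\to 0$ as $n\to\infty$ if and only if $T(p)<\infty$. (ii) If $\mu$ is any (not necessarily product) probability measure on $\{0,1\}^{\mathbb N}$ with $T(\mu)<\infty$, then $\Delta_n(\mu)\to0$ as $n\to\infty$.
   Context: $\mathbb N=\{1,2,3,\dots\}$; $\log$ is the natural logarithm. $\{0,1\}^{\mathbb N}$ carries the $\sigma$-algebra generated by finite-dimensional cylinders. For a probability measure $\mu$ on $\{0,1\}^{\mathbb N}$, let $p=\mathbb E_{X\sim\mu}[X]\in[0,1]^{\mathbb N}$ be its mean, i.e. $p(j)=\mathbb E[X(j)]$. Given $n$ i.i.d. draws $X_1,\dots,X_n\sim\mu$, let $\hat p_n(j)=\frac1n\sum_{i=1}^nX_i(j)$ and $\Delta_n(\mu)=\mathbb E\sup_{j\in\mathbb N}|\hat p_n(j)-p(j)|$. For $p\in[0,1]^{\mathbb N}$, $\Delta_n(p)$ denotes $\Delta_n(\mu)$ for the product measure $\mu=\bigotimes_{j}\mathrm{Bernoulli}(p(j))$ (coordinates independent). $[0,\frac12]^{\mathbb N}_{\downarrow0}$ is the set of all non-increasing sequences $p:\mathbb N\to[0,\frac12]$ with $p(j)\to0$. For such $p$, $$T(p)=\sup_{j\in\mathbb N}\frac{\log(j+1)}{\log(1/p(j))},$$ where a term with $p(j)=0$ is interpreted as $0$. For a general $\mu$ with mean $p$, put $\tilde p(j)=\min\{p(j),1-p(j)\}$. If $\tilde p(j)\to0$, let $\tilde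 p^{\downarrow}$ be its non-increasing rearrangement ($\tilde p^{\downarrow}(j)$ is the $j$-th largest entry of $\tilde p$, counted with multiplicity) and set $T(\mu)=T(\tilde p^{\downarrow})$; otherwise set $T(\mu)=\infty$. *)

theory Defs
  imports "HOL-Probability.Probability"
begin

text \<open>
  Coordinates are indexed from 0: index \<open>k\<close> stands for the coordinate \<open>j = Suc k\<close> of the
  sequence indexed by \<open>{1, 2, 3, \<dots>}\<close>. A point of \<open>{0,1}\<^sup>\<nat>\<close> is a function \<open>nat \<Rightarrow> bool\<close>.
\<close>

definition cube :: "(nat \<Rightarrow> bool) measure" where
  "cube = PiM UNIV (\<lambda>_. count_space UNIV)"

definition mean :: "(nat \<Rightarrow> bool) measure \<Rightarrow> nat \<Rightarrow> real" where
  "mean \<mu> k = (\<integral>x. of_bool (x k) \<partial>\<mu>)"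

definition emp_mean :: "nat \<Rightarrow> (nat \<Rightarrow> nat \<Rightarrow> bool) \<Rightarrow> nat \<Rightarrow> real" where
  "emp_mean n X k = (\<Sum>i<n. of_bool (X i k)) / real n"

text \<open>
  The \<open>n\<close> i.i.d. draws are the coordinates of the \<open>n\<close>-fold product measure. The supremum ranges
  over a subset of \<open>[0,1]\<close> and is integrable, see \<open>integrable_sup_deviation\<close> below.
\<close>

definition Delta :: "nat \<Rightarrow> (nat \<Rightarrow> bool) measure \<Rightarrow> real" where
  "Delta n \<mu> = (\<integral>X. (SUP k. \<bar>emp_mean n X k - mean \<mu> k\<bar>) \<partial>(PiM {..<n} (\<lambda>_. \<mu>)))"

definition bernoulli_product :: "(nat \<Rightarrow> real) \<Rightarrow> (nat \<Rightarrow> bool) measure" where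
  "bernoulli_product p = PiM UNIV (\<lambda>k. measure_pmf (bernoulli_pmf (p k)))"

definition dec_null_seqs :: "(nat \<Rightarrow> real) set" where
  "dec_null_seqs = {p. (\<forall>k. p k \<in> {0..1/2}) \<and> decseq p \<and> p \<longlonglongrightarrow> 0}"

definition T_seq :: "(nat \<Rightarrow> real) \<Rightarrow> ereal" where
  "T_seq p = (SUP k. if p k = 0 then 0 else ereal (ln (real (Suc k) + 1) / ln (1 / p k)))"

definition fold_half :: "(nat \<Rightarrow> real) \<Rightarrow> nat \<Rightarrow> real" where
  "fold_half p k = min (p k) (1 - p k)"

text \<open>
  Greedy selection: \<open>top_indices q k\<close> consists of \<open>k\<close> indices carrying the \<open>k\<close> largest entries of
  \<open>q\<close>, counted with multiplicity. Maxima over the remaining indices are attained when \<open>q\<close> is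
  nonnegative and tends to 0.
\<close>

primrec top_indices :: "(nat \<Rightarrow> real) \<Rightarrow> nat \<Rightarrow> nat set" where
  "top_indices q 0 = {}"
| "top_indices q (Suc k) = insert (arg_max_on q (- top_indices q k)) (top_indices q k)"

definition dec_rearr :: "(nat \<Rightarrow> real) \<Rightarrow> nat \<Rightarrow> real" where
  "dec_rearr q k = q (arg_max_on q (- top_indices q k))"

definition T_meas :: "(nat \<Rightarrow> bool) measure \<Rightarrow> ereal" where
  "T_meas \<mu> =
    (if fold_half (mean \<mu>) \<longlonglongrightarrow> 0 then T_seq (dec_rearr (fold_half (mean \<mu>))) else \<infinity>)"


lemma sets_bernoulli_product: "sets (bernoulli_product p) = sets cube"
  unfolding bernoulli_product_def cube_def by (rule sets_PiM_cong) auto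

lemma prob_space_bernoulli_product: "prob_space (bernoulli_product p)"
  unfolding bernoulli_product_def by (intro prob_space_PiM prob_space_measure_pmf)

lemma mean_bernoulli_product:
  assumes "p k \<in> {0..1}"
  shows "mean (bernoulli_product p) k = p k"
proof -
  interpret product_prob_space "\<lambda>k. measure_pmf (bernoulli_pmf (p k))" UNIV
    by (simp add: product_prob_spaceI prob_space_measure_pmf)
  have "mean (bernoulli_product p) k
      = (\<integral>b. of_bool b \<partial>distr (bernoulli_product p) (measure_pmf (bernoulli_pmf (p k))) (\<lambda>x. x k))"
    unfolding mean_def bernoulli_product_def by (subst integral_distr) auto
  also have "\<dots> = (\<integral>b. of_bool b \<partial>measure_pmf (bernoulli_pmf (p k)))"
    unfolding bernoulli_product_def by (subst PiM_component) auto
  also have "\<dots> = p k"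
    using assms by (simp add: integral_bernoulli_pmf)
  finally show ?thesis .
qed

lemma integrable_sup_deviation:
  assumes "prob_space \<mu>" "sets \<mu> = sets cube"
  shows "integrable (PiM {..<n} (\<lambda>_. \<mu>)) (\<lambda>X. SUP k. \<bar>emp_mean n X k - mean \<mu> k\<bar>)"
proof -
  interpret \<mu>: prob_space \<mu> by fact
  interpret P: prob_space "PiM {..<n} (\<lambda>_. \<mu>)"
    by (intro prob_space_PiM assms(1))
  have coord: "(\<lambda>x. x k) \<in> measurable \<mu> (count_space UNIV)" for k
    unfolding measurable_cong_sets[OF assms(2) refl] cube_def
    by (rule measurable_component_singleton) simp
  have coord2: "(\<lambda>X. X i k) \<in> measurable (PiM {..<n} (\<lambda>_. \<mu>)) (count_space UNIV)"
    if "i < n" for i k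
    by (rule measurable_compose[OF measurable_component_singleton[where M = "\<lambda>_. \<mu>"] coord])
      (use that in simp)
  have emp: "(\<lambda>X. emp_mean n X k) \<in> borel_measurable (PiM {..<n} (\<lambda>_. \<mu>))" for k
    unfolding emp_mean_def
    by (intro borel_measurable_divide borel_measurable_sum borel_measurable_const
        measurable_compose[OF coord2]) auto
  have emp01: "0 \<le> emp_mean n X k" "emp_mean n X k \<le> 1" for X k
  proof -
    have "(\<Sum>i<n. of_bool (X i k) :: real) \<le> (\<Sum>i<n. 1)" by (intro sum_mono) auto
    then show "emp_mean n X k \<le> 1"
      unfolding emp_mean_def by (cases "n = 0") (auto simp: divide_le_eq_1)
    show "0 \<le> emp_mean n X k"
      unfolding emp_mean_def by (intro divide_nonneg_nonneg sum_nonneg) auto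
  qed
  have mean01: "0 \<le> mean \<mu> k" "mean \<mu> k \<le> 1" for k
  proof -
    have "integrable \<mu> (\<lambda>x. of_bool (x k) :: real)"
      by (rule \<mu>.integrable_const_bound[where B = 1])
        (auto intro: measurable_compose[OF coord])
    then show "mean \<mu> k \<le> 1"
      unfolding mean_def by (rule \<mu>.integral_le_const) auto
    show "0 \<le> mean \<mu> k"
      unfolding mean_def by (rule integral_nonneg_AE) auto
  qed
  have le1: "\<bar>emp_mean n X k - mean \<mu> k\<bar> \<le> 1" for X k
    using emp01[of X k] mean01[of k] by linarith
  then have bdd: "bdd_above (range (\<lambda>k. \<bar>emp_mean n X k - mean \<mu> k\<bar>))" for X
    by (intro bdd_aboveI2)
  have "\<bar>SUP k. \<bar>emp_mean n X k - mean \<mu> k\<bar>\<bar> \<le> 1" for X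
  proof (rule abs_leI)
    show "(SUP k. \<bar>emp_mean n X k - mean \<mu> k\<bar>) \<le> 1"
      by (intro cSUP_least le1) auto
    have "0 \<le> (SUP k. \<bar>emp_mean n X k - mean \<mu> k\<bar>)"
      by (rule cSUP_upper2[OF bdd[of X] UNIV_I[of 0]]) simp
    then show "- (SUP k. \<bar>emp_mean n X k - mean \<mu> k\<bar>) \<le> 1" by linarith
  qed
  moreover have "(\<lambda>X. SUP k. \<bar>emp_mean n X k - mean \<mu> k\<bar>)
      \<in> borel_measurable (PiM {..<n} (\<lambda>_. \<mu>))"
    by (intro borel_measurable_cSUP borel_measurable_abs borel_measurable_diff emp bdd) auto
  ultimately show ?thesis
    by (intro P.integrable_const_bound[where B = 1]) auto
qed

lemma finite_ge_of_null:
  fixes q :: "nat \<Rightarrow> real"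
  assumes "q \<longlonglongrightarrow> 0" "0 < t"
  shows "finite {k. t \<le> q k}"
proof -
  have "eventually (\<lambda>k. q k < t) sequentially"
    using order_tendstoD(2)[OF assms] .
  then show ?thesis
    by (simp add: cofinite_eq_sequentially[symmetric] eventually_cofinite not_less)
qed

lemma arg_max_on_null:
  fixes q :: "nat \<Rightarrow> real"
  assumes "\<And>k. 0 \<le> q k" "q \<longlonglongrightarrow> 0" "S \<noteq> {}"
  shows "arg_max_on q S \<in> S \<and> (\<forall>k\<in>S. q k \<le> q (arg_max_on q S))"
proof -
  have "\<exists>m\<in>S. \<forall>k\<in>S. q k \<le> q m"
  proof (cases "\<exists>a\<in>S. 0 < q a")
    case True
    then obtain a where a: "a \<in> S" "0 < q a" by blast
    let ?F = "{k. q a \<le> q k} \<inter> S"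
    have F: "finite ?F" "?F \<noteq> {}" using finite_ge_of_null[OF assms(2) a(2)] a by auto
    then have "Max (q ` ?F) \<in> q ` ?F" by simp
    then obtain m where m: "m \<in> ?F" "q m = Max (q ` ?F)" by force
    have "q k \<le> q m" if "k \<in> S" for k
    proof (cases "q a \<le> q k")
      case True
      then show ?thesis using F that m by simp
    next
      case False
      then show ?thesis using m by simp
    qed
    then show ?thesis using m by blast
  next
    case False
    then show ?thesis using assms(1,3) by (metis all_not_in_conv not_le order.trans)
  qed
  then obtain m where "is_arg_max q (\<lambda>x. x \<in> S) m" by (auto simp: is_arg_max_linorder)
  then have "is_arg_max q (\<lambda>x. x \<in> S) (arg_max_on q S)"
    unfolding arg_max_on_def arg_max_def by (rule someI)
  then show ?thesis by (auto simp: is_arg_max_linorder)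
qed

lemma dec_rearr_null:
  assumes "\<And>k. 0 \<le> q k" "q \<longlonglongrightarrow> 0"
  shows "decseq (dec_rearr q)"
    and "\<exists>\<sigma>. inj \<sigma> \<and> dec_rearr q = q \<circ> \<sigma> \<and> {k. q k \<noteq> 0} \<subseteq> range \<sigma>"
proof -
  define \<sigma> where "\<sigma> k = arg_max_on q (- top_indices q k)" for k
  have top: "top_indices q k = \<sigma> ` {..<k}" for k
    by (induction k) (auto simp: \<sigma>_def lessThan_Suc)
  have ne: "- top_indices q k \<noteq> {}" for k
  proof
    assume "- top_indices q k = {}"
    then have "finite (UNIV :: nat set)"
      using top[of k] by (metis double_compl Compl_empty_eq finite_imageI finite_lessThan)
    then show False by simp
  qed
  have s: "\<sigma> k \<notin> \<sigma> ` {..<k}" "\<And>j. j \<notin> \<sigma> ` {..<k} \<Longrightarrow> q j \<le> q (\<sigma> k)" for k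
  proof -
    have "\<sigma> k \<in> - top_indices q k \<and> (\<forall>j \<in> - top_indices q k. q j \<le> q (\<sigma> k))"
      unfolding \<sigma>_def by (rule arg_max_on_null[OF assms ne])
    then show "\<sigma> k \<notin> \<sigma> ` {..<k}" "\<And>j. j \<notin> \<sigma> ` {..<k} \<Longrightarrow> q j \<le> q (\<sigma> k)"
      unfolding top by blast+
  qed
  have inj: "inj \<sigma>"
    by (rule linorder_injI) (use s(1) in \<open>metis imageI lessThan_iff\<close>)
  have rearr: "dec_rearr q = q \<circ> \<sigma>"
    by (auto simp: dec_rearr_def \<sigma>_def)
  show "decseq (dec_rearr q)"
    unfolding rearr decseq_Suc_iff comp_def
    by (intro allI s(2)) (use inj in \<open>auto dest!: injD\<close>)
  have "j \<in> range \<sigma>" if "q j \<noteq> 0" for j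
  proof (rule ccontr)
    assume "j \<notin> range \<sigma>"
    then have "range \<sigma> \<subseteq> {k. q j \<le> q k}" using s(2) by blast
    moreover have "finite {k. q j \<le> q k}"
      using finite_ge_of_null[OF assms(2)] assms(1)[of j] that by simp
    ultimately show False
      using inj finite_subset range_inj_infinite by blast
  qed
  then show "\<exists>\<sigma>. inj \<sigma> \<and> dec_rearr q = q \<circ> \<sigma> \<and> {k. q k \<noteq> 0} \<subseteq> range \<sigma>"
    using inj rearr by blast
qed

end

theory Submission
  imports Defs
begin

text \<open>
  Upper bound: flipping the coordinates with mean above \<open>1/2\<close> turns the deviations into those of
  a sequence with small means \<open>q k\<close>. A union bound over the subsets of the sample gives
  \<open>P(\<epsilon> < deviation at k) \<le> 2^n * (q k)^(\<epsilon> n)\<close> as soon as \<open>q k \<le> \<epsilon>\<close>, and finiteness of \<open>T\<close> means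
  \<open>q k \<le> (k + 2)^(-a)\<close> along the rearrangement for some \<open>a > 0\<close>. Hence, for large \<open>n\<close>, these bounds
  are summable beyond a fixed index with a sum of order \<open>2^(-n)\<close>; the finitely many remaining
  coordinates are handled by Hoeffding's inequality.

  Lower bound: if \<open>T\<close> is infinite, then for every \<open>n\<close> there is a \<open>K\<close> with \<open>(K + 1) (p K)^n \<ge> 1\<close>, so
  by independence some coordinate \<open>k \<le> K\<close> equals 1 in all \<open>n\<close> draws with probability at least
  \<open>1/2\<close>; the deviation there is at least \<open>1/2\<close>.
\<close>

section \<open>Union bounds and independence in product measures\<close>

lemma sets_PiM_Collect_all:
  assumes "J \<subseteq> I" "finite J" "\<And>i. i \<in> J \<Longrightarrow> X i \<in> sets (M i)"
  shows "{x \<in> space (Pi\<^sub>M I M). \<forall>i\<in>J. x i \<in> X i} \<in> sets (Pi\<^sub>M I M)"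
proof -
  have "{x \<in> space (Pi\<^sub>M I M). \<forall>i\<in>J. x i \<in> X i} = prod_emb I M J (Pi\<^sub>E J X)"
    unfolding prod_emb_def using assms by (auto simp: space_PiM Pi_iff)
  then show ?thesis using assms by (simp add: sets_PiM_I)
qed

lemma (in product_prob_space) measure_PiM_Collect:
  assumes "J \<subseteq> I" "finite J" "\<And>i. i \<in> J \<Longrightarrow> X i \<in> sets (M i)"
  shows "measure (Pi\<^sub>M I M) {x \<in> space (Pi\<^sub>M I M). \<forall>i\<in>J. x i \<in> X i}
    = (\<Prod>i\<in>J. measure (M i) (X i))"
  using emeasure_PiM_Collect[OF assms]
  unfolding P.emeasure_eq_measure M.emeasure_eq_measure
  by (simp add: prod_ennreal measure_nonneg prod_nonneg)

text \<open>When at least \<open>t\<close> draws hit \<open>E\<close>, the set of hitting indices is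
  one of at most \<open>2 ^ card I\<close> subsets \<open>A\<close> of \<open>I\<close> with
  \<open>t \<le> card A\<close>. By independence all draws in such an \<open>A\<close> hit
  \<open>E\<close> with probability \<open>prob E ^ card A\<close>, which is at most
  \<open>prob E powr t\<close>. A real threshold \<open>t\<close> avoids rounding
  \<open>\<epsilon> * n\<close> later.\<close>

lemma (in prob_space) prob_card_hits_ge:
  assumes "E \<in> events" "finite I" "0 < t"
  shows "measure (PiM I (\<lambda>_. M)) {X \<in> space (PiM I (\<lambda>_. M)). t \<le> real (card {i \<in> I. X i \<in> E})}
    \<le> 2 ^ card I * prob E powr t"
proof -
  interpret P: product_prob_space "\<lambda>_. M" I
    by (simp add: product_prob_spaceI prob_space_axioms)
  let ?P = "PiM I (\<lambda>_. M)"
  let ?B = "\<lambda>A. {X \<in> space ?P. \<forall>i\<in>A. X i \<in> E}"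
  let ?F = "{A \<in> Pow I. t \<le> real (card A)}"
  have B: "?B A \<in> sets ?P" "measure ?P (?B A) = prob E ^ card A" if "A \<subseteq> I" for A
  proof -
    have fin: "finite A" using that assms(2) by (rule finite_subset)
    show "?B A \<in> sets ?P"
      using that fin assms(1) by (intro sets_PiM_Collect_all) auto
    show "measure ?P (?B A) = prob E ^ card A"
      using that fin assms(1) by (subst P.measure_PiM_Collect) auto
  qed
  have "{X \<in> space ?P. t \<le> real (card {i \<in> I. X i \<in> E})} \<subseteq> (\<Union>A\<in>?F. ?B A)"
  proof
    fix X assume "X \<in> {X \<in> space ?P. t \<le> real (card {i \<in> I. X i \<in> E})}"
    then show "X \<in> (\<Union>A\<in>?F. ?B A)" by (intro UN_I[of "{i \<in> I. X i \<in> E}"]) auto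
  qed
  then have "measure ?P {X \<in> space ?P. t \<le> real (card {i \<in> I. X i \<in> E})} \<le> measure ?P (\<Union>A\<in>?F. ?B A)"
    using assms(2) B(1) by (intro P.finite_measure_mono) auto
  also have "\<dots> \<le> (\<Sum>A\<in>?F. measure ?P (?B A))"
    using assms(2) B by (intro measure_UNION_le) auto
  also have "\<dots> \<le> (\<Sum>A\<in>?F. prob E powr t)"
  proof (rule sum_mono)
    fix A assume A: "A \<in> ?F"
    \<comment> \<open>This settles the case \<open>prob E = 0\<close>: \<open>0 powr t\<close> is 0,
      whereas \<open>0 ^ card A\<close> would be 1 for an empty \<open>A\<close>.\<close>
    then have pos: "0 < card A" using assms(3) by (intro Nat.gr0I) auto
    have "prob E ^ card A \<le> prob E powr t"
    proof (cases "prob E = 0")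
      case False
      then have "0 < prob E" using measure_nonneg[of M E] by linarith
      then have "prob E ^ card A = prob E powr real (card A)" by (simp add: powr_realpow)
      also have "\<dots> \<le> prob E powr t" using A by (intro powr_mono') auto
      finally show ?thesis .
    qed (use pos in \<open>simp add: power_0_left\<close>)
    then show "measure ?P (?B A) \<le> prob E powr t" using A B by simp
  qed
  also have "\<dots> = real (card ?F) * prob E powr t" by simp
  also have "\<dots> \<le> real (card (Pow I)) * prob E powr t"
    using assms(2) by (intro mult_right_mono of_nat_mono card_mono) auto
  finally show ?thesis using assms(2) by (simp add: card_Pow)
qed

text \<open>Independence passes to complements. The induction on \<open>L\<close> is over the
  stronger claim for mixed events, in which all \<open>A k\<close> with \<open>k\<close> in
  \<open>S\<close> occur and none with \<open>k\<close> in \<open>L\<close> does: moving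
  \<open>l\<close> into \<open>L\<close> subtracts the mixed event with \<open>l\<close> added to
  \<open>S\<close>.\<close>

lemma (in prob_space) prob_product_complements:
  fixes A :: "'i \<Rightarrow> 'a set"
  assumes A: "\<And>k. A k \<in> events"
    and prod: "\<And>S. finite S \<Longrightarrow> prob {x \<in> space M. \<forall>k\<in>S. x \<in> A k} = (\<Prod>k\<in>S. prob (A k))"
    and "finite L"
  shows "prob {x \<in> space M. \<forall>k\<in>L. x \<notin> A k} = (\<Prod>k\<in>L. 1 - prob (A k))"
proof -
  let ?E = "\<lambda>S L. {x \<in> space M. (\<forall>k\<in>S. x \<in> A k) \<and> (\<forall>k\<in>L. x \<notin> A k)}"
  have E: "?E S L \<in> events" if "finite S" "finite L" for S L
    using that A by measurable
  have "finite S \<Longrightarrow> S \<inter> L = {} \<Longrightarrow>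
      prob (?E S L) = (\<Prod>k\<in>S. prob (A k)) * (\<Prod>k\<in>L. 1 - prob (A k))" for S
    using \<open>finite L\<close>
  proof (induction L arbitrary: S)
    case empty
    then show ?case by (simp add: prod)
  next
    case (insert l L)
    have "?E S (insert l L) = ?E S L - ?E (insert l S) L" by auto
    then have "prob (?E S (insert l L)) = prob (?E S L) - prob (?E (insert l S) L)"
      using insert E[of S L] E[of "insert l S" L]
      by (simp only:) (rule finite_measure_Diff, auto)
    also have "prob (?E S L) = (\<Prod>k\<in>S. prob (A k)) * (\<Prod>k\<in>L. 1 - prob (A k))"
      using insert by auto
    also have "prob (?E (insert l S) L) = (\<Prod>k\<in>insert l S. prob (A k)) * (\<Prod>k\<in>L. 1 - prob (A k))"
      using insert by (intro insert.IH) auto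
    also have "(\<Prod>k\<in>insert l S. prob (A k)) = prob (A l) * (\<Prod>k\<in>S. prob (A k))"
      using insert by (subst prod.insert) auto
    finally show ?case using insert by (simp add: algebra_simps)
  qed
  from this[of "{}"] show ?thesis by simp
qed

section \<open>Random points of the cube: deviation tails of a single coordinate\<close>

locale cube_prob = prob_space \<mu> for \<mu> :: "(nat \<Rightarrow> bool) measure" +
  assumes sets_eq: "sets \<mu> = sets cube"
begin

abbreviation "sample n \<equiv> PiM {..<n} (\<lambda>_. \<mu>)"

abbreviation "deviation n X k \<equiv> \<bar>emp_mean n X k - mean \<mu> k\<bar>"

lemma space_eq: "space \<mu> = UNIV"
  using sets_eq_imp_space_eq[OF sets_eq] by (simp add: cube_def space_PiM)

sublocale sample: product_prob_space "\<lambda>_. \<mu>" "{..<n}" for n :: nat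
  by (simp add: product_prob_spaceI prob_space_axioms)

lemma measurable_coord: "(\<lambda>x. x k) \<in> measurable \<mu> (count_space UNIV)"
  unfolding measurable_cong_sets[OF sets_eq refl] cube_def
  by (rule measurable_component_singleton) simp

lemma measurable_sample_coord [measurable]:
  "i < n \<Longrightarrow> (\<lambda>X. X i k) \<in> measurable (sample n) (count_space UNIV)"
  by (rule measurable_compose[OF measurable_component_singleton[where M = "\<lambda>_. \<mu>"] measurable_coord])
    simp

lemma measurable_emp_mean [measurable]: "(\<lambda>X. emp_mean n X k) \<in> borel_measurable (sample n)"
  unfolding emp_mean_def
  by (intro borel_measurable_divide borel_measurable_sum borel_measurable_const
      measurable_compose[OF measurable_sample_coord]) auto

lemma coord_event: "{x. x k = b} \<in> events"
  using measurable_sets[OF measurable_coord, of "{b}" k] by (simp add: vimage_def space_eq)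

lemma mean_eq_prob: "mean \<mu> k = prob {x. x k}"
proof -
  have "mean \<mu> k = (\<integral>x. indicator {x. x k} x \<partial>\<mu>)"
    unfolding mean_def by (intro Bochner_Integration.integral_cong) (auto simp: indicator_def)
  then show ?thesis using coord_event[of k True] by (simp add: space_eq)
qed

lemma mean_bounds: "0 \<le> mean \<mu> k" "mean \<mu> k \<le> 1"
  by (simp_all add: mean_eq_prob)

text \<open>The event says that coordinate \<open>k\<close> takes its rarer value:
  \<open>True\<close> if the mean is at most 1/2, \<open>False\<close> otherwise. This is how
  coordinates are flipped without changing the measure.\<close>

lemma fold_half_eq_prob: "fold_half (mean \<mu>) k = prob {x. x k = (mean \<mu> k \<le> 1/2)}"
proof -
  have "prob {x. \<not> x k} = 1 - mean \<mu> k"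
    using prob_compl[OF coord_event[of k True]]
    by (simp add: mean_eq_prob space_eq Compl_eq_Diff_UNIV[symmetric] Collect_neg_eq)
  then show ?thesis by (auto simp: fold_half_def mean_eq_prob min_def)
qed

lemma emp_mean_bounds: "0 \<le> emp_mean n X k" "emp_mean n X k \<le> 1"
proof -
  have "(\<Sum>i<n. of_bool (X i k) :: real) \<le> (\<Sum>i<n. 1)" by (intro sum_mono) auto
  then show "emp_mean n X k \<le> 1"
    unfolding emp_mean_def by (cases "n = 0") (auto simp: divide_le_eq_1)
  show "0 \<le> emp_mean n X k"
    unfolding emp_mean_def by (intro divide_nonneg_nonneg sum_nonneg) auto
qed

lemma deviation_le_1: "deviation n X k \<le> 1"
  using emp_mean_bounds[of n X k] mean_bounds[of k] by linarith

lemma bdd_above_deviation: "bdd_above (range (deviation n X))"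
  by (rule bdd_aboveI2[where M = 1]) (rule deviation_le_1)

lemma deviation_event: "{X \<in> space (sample n). \<epsilon> < deviation n X k} \<in> sets (sample n)"
  by measurable

text \<open>This bound holds for every coordinate whatever its mean, but it is uniform in
  \<open>k\<close> and so can be summed only over finitely many coordinates.\<close>

lemma prob_deviation_Hoeffding:
  assumes "0 < n" "0 \<le> \<epsilon>"
  shows "measure (sample n) {X \<in> space (sample n). \<epsilon> < deviation n X k}
    \<le> 2 * exp (- 2 * real n * \<epsilon>\<^sup>2)"
proof -
  let ?f = "\<lambda>i X. of_bool (X i k) :: real"
  have comp: "distr (sample n) \<mu> (\<lambda>X. X i) = \<mu>" if "i < n" for i
    using sample.PiM_component[of i n] that by simp
  \<comment> \<open>Points of the product space are extensional, so the restriction fixes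
    them.\<close>
  have id: "distr (sample n) (sample n) (\<lambda>X. \<lambda>i\<in>{..<n}. X i) = sample n"
    by (rule trans[OF distr_cong distr_id]) (auto simp: space_PiM PiE_iff extensional_restrict)
  \<comment> \<open>The draws are independent because their joint law and the product of their
    marginals are both \<open>sample n\<close>.\<close>
  have "sample.indep_vars n (\<lambda>_. \<mu>) (\<lambda>i X. X i) {..<n}"
  proof (subst sample.indep_vars_iff_distr_eq_PiM')
    show "{..<n} \<noteq> {}" using assms by auto
    show "distr (sample n) (sample n) (\<lambda>X. \<lambda>i\<in>{..<n}. X i)
        = (\<Pi>\<^sub>M i\<in>{..<n}. distr (sample n) \<mu> (\<lambda>X. X i))"
      unfolding id by (intro PiM_cong) (auto simp: comp)
  qed (auto intro: measurable_component_singleton[where M = "\<lambda>_. \<mu>"])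
  then have indep: "sample.indep_vars n (\<lambda>_. borel) ?f {..<n}"
    by (rule sample.indep_vars_compose2) (auto intro: measurable_compose[OF measurable_coord])
  have distr: "distr (sample n) borel (?f i) = distr \<mu> borel (\<lambda>x. of_bool (x k))" if "i < n" for i
  proof -
    have "distr (distr (sample n) \<mu> (\<lambda>X. X i)) borel (\<lambda>x. of_bool (x k) :: real)
        = distr (sample n) borel (?f i)"
      using that measurable_component_singleton[where M = "\<lambda>_. \<mu>", of i "{..<n}"]
      by (subst distr_distr) (auto simp: comp_def intro: measurable_compose[OF measurable_coord])
    then show ?thesis using comp[OF that] by simp
  qed
  have f0: "?f 0 \<in> borel_measurable (sample n)"
    using assms by (intro measurable_compose[OF measurable_sample_coord]) auto
  have expect: "(\<integral>X. ?f 0 X \<partial>sample n) = mean \<mu> k"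
  proof -
    have "(\<integral>X. ?f 0 X \<partial>sample n) = (\<integral>y. y \<partial>distr (sample n) borel (?f 0))"
      using f0 by (subst integral_distr) auto
    also have "\<dots> = mean \<mu> k"
      unfolding distr[OF assms(1)] mean_def
      by (subst integral_distr) (auto intro: measurable_compose[OF measurable_coord])
    finally show ?thesis .
  qed
  interpret H: Hoeffding_ineq_iid "sample n" "{..<n}" ?f "?f 0" 0 1 "mean \<mu> k"
  proof unfold_locales
    show "sample.indep_vars n (\<lambda>_. borel) ?f {..<n}" by (fact indep)
    show "mean \<mu> k \<equiv> \<integral>X. ?f 0 X \<partial>sample n" using expect by simp
  qed (use assms f0 in \<open>auto simp: distr\<close>)
  have "measure (sample n) {X \<in> space (sample n). \<epsilon> < deviation n X k}
      \<le> measure (sample n) {X \<in> space (sample n). \<epsilon> \<le> deviation n X k}"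
    by (intro sample.finite_measure_mono) auto
  also have "\<dots> \<le> 2 * exp (- 2 * real n * \<epsilon>\<^sup>2)"
    using H.Hoeffding_ineq_abs_ge'[OF assms(2)] assms(1) by (simp add: emp_mean_def lessThan_empty_iff)
  finally show ?thesis .
qed

text \<open>The rarer value has probability at most \<open>\<epsilon>\<close>, so its frequency
  cannot fall short of that probability by more than \<open>\<epsilon>\<close>. A deviation above
  \<open>\<epsilon>\<close> is therefore an excess, and at least \<open>\<epsilon> * n\<close> draws
  take the rarer value; \<open>prob_card_hits_ge\<close> bounds the probability of this.\<close>

lemma prob_deviation_small_mean:
  assumes "0 < n" "0 < \<epsilon>" "fold_half (mean \<mu>) k \<le> \<epsilon>"
  shows "measure (sample n) {X \<in> space (sample n). \<epsilon> < deviation n X k}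
    \<le> 2 ^ n * fold_half (mean \<mu>) k powr (\<epsilon> * real n)"
proof -
  define E where "E = {x :: nat \<Rightarrow> bool. x k = (mean \<mu> k \<le> 1/2)}"
  have E: "E \<in> events" unfolding E_def by (rule coord_event)
  have hits: "\<epsilon> * real n \<le> real (card {i \<in> {..<n}. X i \<in> E})" if "\<epsilon> < deviation n X k" for X
  proof -
    have "real (card {i \<in> {..<n}. X i \<in> E}) = (\<Sum>i<n. of_bool (X i \<in> E))"
      by (simp add: of_bool_def sum.If_cases Int_def)
    also have "\<dots> = real n * (if mean \<mu> k \<le> 1/2 then emp_mean n X k else 1 - emp_mean n X k)"
    proof (cases "mean \<mu> k \<le> 1/2")
      case True
      then show ?thesis using assms(1) by (simp add: E_def emp_mean_def)
    next
      case False
      have "(\<Sum>i<n. of_bool (\<not> X i k) :: real) = (\<Sum>i<n. 1 - of_bool (X i k))"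
        by (intro sum.cong) auto
      then show ?thesis using False assms(1)
        by (simp add: E_def emp_mean_def sum_subtractf right_diff_distrib del: sum_of_bool_eq)
    qed
    also have "\<dots> \<ge> real n * \<epsilon>"
      using that assms(3) emp_mean_bounds[of n X k] mean_bounds[of k]
      by (intro mult_left_mono) (auto simp: fold_half_def min_def split: if_splits)
    finally show ?thesis by (simp add: mult.commute)
  qed
  have sets: "{X \<in> space (sample n). \<epsilon> * real n \<le> real (card {i \<in> {..<n}. X i \<in> E})} \<in> sets (sample n)"
  proof -
    have "(\<lambda>X. real (card {i \<in> {..<n}. X i \<in> E})) = (\<lambda>X. \<Sum>i<n. of_bool (X i k = (mean \<mu> k \<le> 1/2)))"
      by (rule ext) (simp add: of_bool_def sum.If_cases Int_def E_def)
    moreover have "\<dots> \<in> borel_measurable (sample n)"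
      by (intro borel_measurable_sum measurable_compose[OF measurable_sample_coord]) auto
    ultimately have [measurable]: "(\<lambda>X. real (card {i \<in> {..<n}. X i \<in> E})) \<in> borel_measurable (sample n)"
      by (simp only:)
    show ?thesis by measurable
  qed
  have "measure (sample n) {X \<in> space (sample n). \<epsilon> < deviation n X k}
      \<le> measure (sample n) {X \<in> space (sample n). \<epsilon> * real n \<le> real (card {i \<in> {..<n}. X i \<in> E})}"
    by (rule sample.P.finite_measure_mono[OF _ sets]) (use hits in blast)
  also have "\<dots> \<le> 2 ^ card {..<n} * prob E powr (\<epsilon> * real n)"
    using assms E by (intro prob_card_hits_ge) auto
  also have "prob E = fold_half (mean \<mu>) k" by (simp add: fold_half_eq_prob E_def)
  finally show ?thesis by simp
qed

section \<open>From single coordinates to the expected supremum\<close>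

lemma Delta_nonneg: "0 \<le> Delta n \<mu>"
proof -
  have "0 \<le> (SUP k. deviation n X k)" for X
    by (rule cSUP_upper2[OF bdd_above_deviation UNIV_I[of 0]]) simp
  then show ?thesis unfolding Delta_def by (intro Bochner_Integration.integral_nonneg) auto
qed

lemma Delta_ge:
  assumes "A \<in> sets (sample n)" "\<And>X. X \<in> A \<Longrightarrow> \<exists>k. c \<le> deviation n X k"
  shows "c * measure (sample n) A \<le> Delta n \<mu>"
proof -
  have "c * indicator A X \<le> (SUP k. deviation n X k)" for X
  proof (cases "X \<in> A")
    case True
    then show ?thesis using assms(2) cSUP_upper2[OF bdd_above_deviation UNIV_I] by fastforce
  next
    case False
    then show ?thesis using cSUP_upper2[OF bdd_above_deviation UNIV_I[of 0]] by simp
  qed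
  then have "(\<integral>X. c * indicator A X \<partial>sample n) \<le> Delta n \<mu>"
    unfolding Delta_def using assms(1)
    by (intro integral_mono integrable_sup_deviation prob_space_axioms sets_eq) 
      (auto simp: sample.emeasure_eq_measure)
  then show ?thesis using assms(1) sets.sets_into_space by (simp add: Int_absorb2)
qed

text \<open>Outside \<open>B\<close> the supremum is at most \<open>\<epsilon>\<close>; on
  \<open>B\<close> the trivial bound 1 applies.\<close>

lemma Delta_le:
  assumes "B \<in> sets (sample n)" "0 \<le> \<epsilon>"
    "\<And>X k. X \<in> space (sample n) \<Longrightarrow> X \<notin> B \<Longrightarrow> deviation n X k \<le> \<epsilon>"
  shows "Delta n \<mu> \<le> \<epsilon> + measure (sample n) B"
proof -
  have "Delta n \<mu> \<le> (\<integral>X. \<epsilon> + indicator B X \<partial>sample n)"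
    unfolding Delta_def
  proof (intro integral_mono integrable_sup_deviation prob_space_axioms sets_eq)
    fix X assume X: "X \<in> space (sample n)"
    show "(SUP k. deviation n X k) \<le> \<epsilon> + indicator B X"
    proof (rule cSUP_least)
      show "deviation n X k \<le> \<epsilon> + indicator B X" for k
        using assms(2) assms(3)[OF X, of k] deviation_le_1[of n X k] by (cases "X \<in> B") auto
    qed simp
  qed (use assms(1) in \<open>auto simp: sample.emeasure_eq_measure\<close>)
  also have "\<dots> = \<epsilon> + measure (sample n) B"
    using assms(1) sample.P.prob_space[of n] sets.sets_into_space[OF assms(1)]
    by (subst Bochner_Integration.integral_add)
      (auto simp: sample.emeasure_eq_measure Int_absorb2)
  finally show ?thesis .
qed

text \<open>The common core of both upper bounds. The map \<open>\<sigma>\<close> enumerates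
  coordinates in an order along which the folded means decay polynomially; it is the identity for a
  monotone sequence and the greedy selection in general. Coordinates outside its range are almost
  surely constant.\<close>

lemma Delta_tendsto_zero:
  assumes "0 < a" "\<And>k. fold_half (mean \<mu>) (\<sigma> k) \<le> real (k + 2) powr - a"
    and supp: "{j. fold_half (mean \<mu>) j \<noteq> 0} \<subseteq> range \<sigma>"
  shows "(\<lambda>n. Delta n \<mu>) \<longlonglongrightarrow> 0"
proof (rule LIMSEQ_I)
  fix r :: real assume "0 < r"
  \<comment> \<open>One half of \<open>r\<close> is the tolerated deviation, the other half will
    dominate the probability that it is exceeded.\<close>
  define \<epsilon> where "\<epsilon> = r / 2"
  have \<epsilon>: "0 < \<epsilon>" using \<open>0 < r\<close> by (simp add: \<epsilon>_def)
  let ?q = "fold_half (mean \<mu>)"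
  let ?D = "\<lambda>n j. {X \<in> space (sample n). \<epsilon> < deviation n X j}"
  let ?c = "\<lambda>k. real (k + 2) powr - 2"
  have q_nonneg: "0 \<le> ?q j" for j
    using mean_bounds[of j] by (simp add: fold_half_def)
  have decay: "(\<lambda>k. real (k + 2) powr - b) \<longlonglongrightarrow> 0" if "0 < b" for b
  proof -
    have "filterlim (\<lambda>k. real (k + 2)) at_top sequentially"
      by (rule filterlim_compose[OF filterlim_real_sequentially filterlim_add_const_nat_at_top])
    then show ?thesis using that by (intro tendsto_neg_powr) auto
  qed
  have "eventually (\<lambda>k. real (k + 2) powr - a < \<epsilon>) sequentially"
    using order_tendstoD(2)[OF decay[OF \<open>0 < a\<close>] \<epsilon>] .
  moreover have "eventually (\<lambda>k. real (k + 2) powr - (a * \<epsilon> / 2) < 1 / 4) sequentially"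
    using order_tendstoD(2)[OF decay, of "a * \<epsilon> / 2" "1 / 4"] \<open>0 < a\<close> \<epsilon> by simp
  \<comment> \<open>Beyond \<open>K\<close> the first inequality makes
    \<open>prob_deviation_small_mean\<close> applicable, and the \<open>n\<close>-th power of the
    second one outweighs the factor \<open>2 ^ n\<close> of that bound.\<close>
  ultimately obtain K where
    K: "\<And>k. K \<le> k \<Longrightarrow> real (k + 2) powr - a < \<epsilon> \<and> real (k + 2) powr - (a * \<epsilon> / 2) < 1 / 4"
    unfolding eventually_sequentially by (metis linorder_le_cases order_trans)
  have summable: "summable ?c"
    using summable_ignore_initial_segment[of "\<lambda>k. real k powr - 2" 2]
    by (simp add: summable_real_powr_iff)
  then have summable_K: "summable (\<lambda>k. ?c (k + K))"
    by (rule summable_ignore_initial_segment)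
  define C where "C = (\<Sum>k. ?c (k + K))"
  let ?bound = "\<lambda>n. real K * (2 * exp (- 2 * real n * \<epsilon>\<^sup>2)) + (1/2) ^ n * C"
  have bound: "Delta n \<mu> \<le> \<epsilon> + ?bound n" if n: "0 < n" "4 \<le> a * \<epsilon> * real n" for n
  proof -
    \<comment> \<open>For a folded mean 0 the bound is exactly 0, since
      \<open>0 powr x = 0\<close>.\<close>
    have null: "measure (sample n) (?D n j) = 0" if "?q j = 0" for j
    proof -
      have "measure (sample n) (?D n j) \<le> 2 ^ n * ?q j powr (\<epsilon> * real n)"
        using n \<epsilon> that by (intro prob_deviation_small_mean) auto
      then show ?thesis using that measure_nonneg[of "sample n" "?D n j"] by auto
    qed
    have tail: "measure (sample n) (?D n (\<sigma> (k + K))) \<le> (1/2) ^ n * ?c (k + K)" for k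
    proof -
      define m where "m = real (k + K + 2)"
      have m: "1 \<le> m" "m powr - a < \<epsilon>" "m powr - (a * \<epsilon> / 2) < 1 / 4"
        using K[of "k + K"] by (auto simp: m_def add_ac)
      have q: "?q (\<sigma> (k + K)) \<le> m powr - a"
        using assms(2)[of "k + K"] by (simp add: m_def)
      have "measure (sample n) (?D n (\<sigma> (k + K))) \<le> 2 ^ n * ?q (\<sigma> (k + K)) powr (\<epsilon> * real n)"
        using n \<epsilon> q m by (intro prob_deviation_small_mean) auto
      also have "\<dots> \<le> 2 ^ n * (m powr - a) powr (\<epsilon> * real n)"
        using q q_nonneg \<epsilon> by (intro mult_left_mono powr_mono2) auto
      \<comment> \<open>The exponent \<open>a * \<epsilon> * n\<close> is split into halves. One
        half yields \<open>(1/4) ^ n\<close>; the other is at least 2 because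
        \<open>4 \<le> a * \<epsilon> * n\<close>, and yields the summable factor
        \<open>m powr - 2\<close>.\<close>
      also have "(m powr - a) powr (\<epsilon> * real n)
          = (m powr - (a * \<epsilon> / 2)) powr real n * m powr - (a * \<epsilon> * real n / 2)"
        using m by (simp add: powr_powr powr_add[symmetric] field_simps)
      also have "\<dots> \<le> (1 / 4) ^ n * m powr - 2"
      proof (intro mult_mono)
        have "(m powr - (a * \<epsilon> / 2)) powr real n = (m powr - (a * \<epsilon> / 2)) ^ n"
          using m by (intro powr_realpow) auto
        also have "\<dots> \<le> (1 / 4) ^ n"
          using m by (intro power_mono) auto
        finally show "(m powr - (a * \<epsilon> / 2)) powr real n \<le> (1 / 4) ^ n" .
        show "m powr - (a * \<epsilon> * real n / 2) \<le> m powr - 2"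
          using m n by (intro powr_mono) auto
      qed auto
      also have "(2::real) ^ n * ((1 / 4) ^ n * m powr - 2) = (1/2) ^ n * m powr - 2"
        by (simp add: power_mult_distrib[symmetric] mult.assoc[symmetric])
      finally show ?thesis by (simp add: m_def mult_left_mono)
    qed
    \<comment> \<open>The exceptional set has three pieces: the first \<open>K\<close> positions of
      the enumeration, the tail with its summable bounds, and the coordinates with folded mean 0.
      The last piece covers all indices outside the range of \<open>\<sigma>\<close> and is a
      countable union of null sets.\<close>
    define B1 where "B1 = (\<Union>k<K. ?D n (\<sigma> k))"
    define B2 where "B2 = (\<Union>k. ?D n (\<sigma> (k + K)))"
    define B3 where "B3 = (\<Union>j\<in>{j. ?q j = 0}. ?D n j)"
    have B: "B1 \<in> sets (sample n)" "B2 \<in> sets (sample n)" "B3 \<in> sets (sample n)"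
      unfolding B1_def B2_def B3_def
      by (intro sets.finite_UN sets.countable_UN sets.countable_UN' deviation_event; auto)+
    have "measure (sample n) B1 \<le> (\<Sum>k<K. measure (sample n) (?D n (\<sigma> k)))"
      unfolding B1_def by (intro measure_UNION_le deviation_event) auto
    also have "\<dots> \<le> (\<Sum>k<K. 2 * exp (- 2 * real n * \<epsilon>\<^sup>2))"
      using n \<epsilon> by (intro sum_mono prob_deviation_Hoeffding) auto
    finally have B1: "measure (sample n) B1 \<le> real K * (2 * exp (- 2 * real n * \<epsilon>\<^sup>2))"
      by simp
    have summable_D: "summable (\<lambda>k. measure (sample n) (?D n (\<sigma> (k + K))))"
      by (rule summable_comparison_test'[OF summable_mult[OF summable_K, of "(1/2) ^ n"], of 0])
        (use tail in auto)
    have "measure (sample n) B2 \<le> (\<Sum>k. measure (sample n) (?D n (\<sigma> (k + K))))"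
      unfolding B2_def using summable_D deviation_event
      by (intro sample.P.finite_measure_subadditive_countably) auto
    also have "\<dots> \<le> (\<Sum>k. (1/2) ^ n * ?c (k + K))"
      by (intro suminf_le tail summable_D summable_mult summable_K)
    also have "\<dots> = (1/2) ^ n * C"
      unfolding C_def by (rule suminf_mult[OF summable_K])
    finally have B2: "measure (sample n) B2 \<le> (1/2) ^ n * C" .
    have "B3 \<in> null_sets (sample n)"
      unfolding B3_def using null deviation_event
      by (intro null_sets_UN') (auto simp: null_sets_def sample.P.emeasure_eq_measure)
    then have B3: "measure (sample n) B3 = 0" by (rule measure_eq_0_null_sets)
    have "Delta n \<mu> \<le> \<epsilon> + measure (sample n) (B1 \<union> B2 \<union> B3)"
    proof (rule Delta_le)
      fix X j assume X: "X \<in> space (sample n)" "X \<notin> B1 \<union> B2 \<union> B3"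
      have "X \<notin> ?D n j"
      proof (cases "?q j = 0")
        case True
        then show ?thesis using X by (auto simp: B3_def)
      next
        case False
        then obtain k where k: "j = \<sigma> k" using supp by auto
        show ?thesis
        proof (cases "k < K")
          case True
          then show ?thesis using X k by (auto simp: B1_def)
        next
          case False
          then obtain i where "k = i + K" by (metis le_add_diff_inverse2 not_less)
          then show ?thesis using X k by (auto simp: B2_def)
        qed
      qed
      then show "deviation n X j \<le> \<epsilon>" using X by auto
    qed (use B \<epsilon> in auto)
    also have "measure (sample n) (B1 \<union> B2 \<union> B3)
        \<le> measure (sample n) B1 + measure (sample n) B2 + measure (sample n) B3"
      using B measure_Un_le[of "B1 \<union> B2" "sample n" B3] measure_Un_le[of B1 "sample n" B2] by simp
    finally show ?thesis using B1 B2 B3 by simp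
  qed
  have "exp (- 2 * real n * \<epsilon>\<^sup>2) = exp (- 2 * \<epsilon>\<^sup>2) ^ n" for n
    using exp_of_nat_mult[of n "- 2 * \<epsilon>\<^sup>2"] by (simp add: mult_ac)
  moreover have "(\<lambda>n. exp (- 2 * \<epsilon>\<^sup>2) ^ n) \<longlonglongrightarrow> 0"
    using \<epsilon> by (intro LIMSEQ_realpow_zero) auto
  ultimately have lim1: "(\<lambda>n. exp (- 2 * real n * \<epsilon>\<^sup>2)) \<longlonglongrightarrow> 0"
    by (simp only:)
  have lim2: "(\<lambda>n. (1/2) ^ n :: real) \<longlonglongrightarrow> 0"
    by (rule LIMSEQ_realpow_zero) auto
  have lim: "?bound \<longlonglongrightarrow> real K * (2 * 0) + 0 * C"
    by (rule tendsto_add[OF tendsto_mult_left[OF tendsto_mult_left[OF lim1]] tendsto_mult_right[OF lim2]])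
  have "eventually (\<lambda>n. ?bound n < \<epsilon>) sequentially"
    by (rule order_tendstoD(2)[OF lim]) (use \<epsilon> in simp)
  moreover have "eventually (\<lambda>n. 4 / (a * \<epsilon>) \<le> real n) sequentially"
    using filterlim_real_sequentially unfolding filterlim_at_top by blast
  ultimately have "eventually (\<lambda>n. norm (Delta n \<mu> - 0) < r) sequentially"
    using eventually_gt_at_top[of 0]
  proof eventually_elim
    case (elim n)
    have "4 \<le> a * \<epsilon> * real n"
      using elim(2) \<open>0 < a\<close> \<epsilon> by (simp add: field_simps)
    then have "Delta n \<mu> < r"
      using bound[of n] elim by (simp add: \<epsilon>_def)
    then show ?case using Delta_nonneg[of n] by simp
  qed
  then show "\<exists>N. \<forall>n\<ge>N. norm (Delta n \<mu> - 0) < r"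
    by (simp add: eventually_sequentially)
qed

end

section \<open>Finiteness of \<open>T\<close> in terms of powers of the index\<close>

text \<open>With \<open>T\<close> below \<open>M\<close>, solving
  \<open>ln (k + 2) / ln (1 / p k) \<le> M\<close> for \<open>p k\<close> gives the exponent
  \<open>a = 1 / M\<close>. The numerator is \<open>ln (j + 1)\<close> at \<open>j = Suc k\<close>,
  and \<open>p k \<le> 1/2\<close> keeps the denominator positive.\<close>

lemma T_seq_finite_decay:
  assumes "\<And>k. 0 \<le> p k" "\<And>k. p k \<le> 1/2" "T_seq p < \<infinity>"
  obtains a where "0 < a" "\<And>k. p k \<le> real (k + 2) powr - a"
proof -
  obtain N :: nat where N: "T_seq p < ereal (real N)"
    using assms(3) less_PInf_Ex_of_nat[of "T_seq p"] by auto
  \<comment> \<open>The added 1 makes \<open>M\<close> visibly positive, so that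
    \<open>1 / M\<close> can serve as exponent.\<close>
  define M where "M = real N + 1"
  have M: "0 < M" by (simp add: M_def)
  have "p k \<le> real (k + 2) powr - (1 / M)" for k
  proof (cases "p k = 0")
    case False
    with assms(1)[of k] have p: "0 < p k" by simp
    have "ereal (ln (real (Suc k) + 1) / ln (1 / p k)) \<le> T_seq p"
      unfolding T_seq_def by (rule SUP_upper2[of k]) (use False in auto)
    also have "\<dots> \<le> ereal M" using N by (cases "T_seq p") (auto simp: M_def)
    finally have "ln (real (k + 2)) / ln (1 / p k) \<le> M" by (simp add: add_ac)
    moreover have "0 < ln (1 / p k)" using p assms(2)[of k] by simp
    ultimately have "ln (real (k + 2)) \<le> M * ln (1 / p k)" by (simp add: divide_le_eq)
    then have "ln (p k) \<le> - (1 / M) * ln (real (k + 2))"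
      using M p by (simp add: ln_div field_simps)
    then have "exp (ln (p k)) \<le> exp (- (1 / M) * ln (real (k + 2)))" by simp
    then show ?thesis using p by (simp add: powr_def)
  qed simp
  then show ?thesis using M by (intro that[of "1 / M"]) auto
qed

lemma T_seq_infinite_witness:
  assumes "\<And>k. 0 \<le> p k" "\<And>k. p k \<le> 1/2" "T_seq p = \<infinity>" "0 < n"
  obtains k where "1 \<le> real (Suc k) * p k ^ n"
proof -
  \<comment> \<open>The factor 2 leaves a spare \<open>p k ^ n\<close>, at most 1/2, in
    \<open>1 < (k + 2) * p k ^ (2 * n)\<close>. It pays for replacing \<open>k + 2\<close> by
    \<open>Suc k\<close>, the number of coordinates up to \<open>k\<close>.\<close>
  have "ereal (2 * real n) < T_seq p" using assms(3) by simp
  then obtain k where "ereal (2 * real n)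
      < (if p k = 0 then 0 else ereal (ln (real (Suc k) + 1) / ln (1 / p k)))"
    unfolding T_seq_def less_SUP_iff by blast
  then have p0: "p k \<noteq> 0" and less: "2 * real n < ln (real (k + 2)) / ln (1 / p k)"
    by (auto split: if_splits simp: add_ac)
  have p: "0 < p k" using p0 assms(1)[of k] by simp
  have "0 < ln (1 / p k)" using p assms(2)[of k] by simp
  then have "2 * real n * ln (1 / p k) < ln (real (k + 2))" using less by (simp add: less_divide_eq)
  then have "0 < ln (real (k + 2) * p k ^ (2 * n))"
    using p by (simp add: ln_mult ln_realpow ln_div)
  then have gt: "1 < real (k + 2) * p k ^ (2 * n)"
    using p by (subst (asm) ln_gt_zero_iff) auto
  define x where "x = p k ^ n"
  have x: "0 < x" using p by (simp add: x_def)
  have "x \<le> p k ^ 1"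
    unfolding x_def using p assms(2)[of k] assms(4) by (intro power_decreasing) auto
  then have x_le: "x \<le> 1/2" using assms(2)[of k] by simp
  have "1 < (real (k + 2) * x) * x"
    using gt by (simp add: x_def power_mult mult.commute[of 2] power2_eq_square mult_ac)
  also have "\<dots> \<le> (real (k + 2) * x) * (1/2)"
    using x x_le by (intro mult_left_mono) auto
  finally have "1 \<le> real (Suc k) * x" using x_le by (simp add: algebra_simps)
  then show ?thesis by (intro that[of k]) (simp add: x_def)
qed

section \<open>Lower bound for independent coordinates\<close>

text \<open>The constant is a deviation of at least 1/2 times a probability of at least 1/2. As it
  does not depend on \<open>n\<close>, it rules out convergence to 0.\<close>

lemma Delta_bernoulli_product_ge:
  assumes p: "\<And>k. 0 \<le> p k" "\<And>k. p k \<le> 1/2" and "decseq p" "T_seq p = \<infinity>" "0 < n"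
  shows "1 / 4 \<le> Delta n (bernoulli_product p)"
proof -
  let ?\<mu> = "bernoulli_product p"
  interpret prob_space ?\<mu> by (rule prob_space_bernoulli_product)
  interpret cube_prob ?\<mu> by unfold_locales (rule sets_bernoulli_product)
  interpret B: product_prob_space "\<lambda>k. measure_pmf (bernoulli_pmf (p k))" UNIV
    by (simp add: product_prob_spaceI prob_space_measure_pmf)
  have mean: "mean ?\<mu> k = p k" for k
    using p[of k] by (intro mean_bernoulli_product) auto
  define A where "A k = {X \<in> space (sample n). \<forall>i\<in>{..<n}. X i \<in> {x. x k}}" for k
  have A_sets: "A k \<in> sets (sample n)" for k
    unfolding A_def using coord_event[of k True] by (intro sets_PiM_Collect_all) auto
  have prod: "measure (sample n) {X \<in> space (sample n). \<forall>k\<in>S. X \<in> A k} = (\<Prod>k\<in>S. p k ^ n)"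
    if "finite S" for S
  proof -
    \<comment> \<open>Exchanging the two quantifiers lets independence be used twice: first across
      the draws, then across the coordinates of a single draw.\<close>
    have "{X \<in> space (sample n). \<forall>k\<in>S. X \<in> A k}
        = {X \<in> space (sample n). \<forall>i\<in>{..<n}. X i \<in> {x. \<forall>k\<in>S. x k}}"
      by (auto simp: A_def)
    moreover have "{x. \<forall>k\<in>S. x k} \<in> events"
    proof -
      have "{x \<in> space ?\<mu>. \<forall>k\<in>S. x k} \<in> events"
        using that coord_event[of _ True]
        by (intro sets.sets_Collect_finite_All) (auto simp: space_eq)
      then show ?thesis by (simp add: space_eq)
    qed
    ultimately have "measure (sample n) {X \<in> space (sample n). \<forall>k\<in>S. X \<in> A k}
        = prob {x. \<forall>k\<in>S. x k} ^ n"
      using sample.measure_PiM_Collect[of "{..<n}" n "\<lambda>_. {x. \<forall>k\<in>S. x k}"] by simp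
    also have "prob {x. \<forall>k\<in>S. x k} = (\<Prod>k\<in>S. p k)"
      using B.measure_PiM_Collect[of S "\<lambda>_. {True}"] that p
      by (simp add: bernoulli_product_def[symmetric] space_eq measure_pmf_single order.trans[OF p(2)])
    finally show ?thesis by (simp add: prod_power_distrib)
  qed
  have le1: "p k \<le> 1" for k using p(2)[of k] by simp
  have A_prob: "measure (sample n) (A k) = p k ^ n" for k
    using prod[of "{k}"] sets.sets_into_space[OF A_sets[of k]] by (simp add: Int_def[symmetric] Int_absorb1)
  obtain K where K: "1 \<le> real (Suc K) * p K ^ n"
    using T_seq_infinite_witness[of p n] assms by blast
  let ?N = "{X \<in> space (sample n). \<forall>k\<in>{..K}. X \<notin> A k}"
  have N: "?N \<in> sets (sample n)"
    using A_sets by measurable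
  have x: "0 \<le> p K ^ n" "p K ^ n \<le> 1"
    using p[of K] by (auto intro!: power_le_one)
  have "measure (sample n) ?N = (\<Prod>k\<in>{..K}. 1 - measure (sample n) (A k))"
    using A_sets prod by (intro sample.P.prob_product_complements) (auto simp: A_prob)
  \<comment> \<open>Monotonicity of \<open>p\<close> makes \<open>p K\<close> the smallest of the
    \<open>K + 1\<close> means.\<close>
  also have "\<dots> \<le> (\<Prod>k\<in>{..K}. 1 - p K ^ n)"
    using p \<open>decseq p\<close>
    by (intro prod_mono) (auto simp: A_prob decseq_def intro!: power_mono power_le_one le1)
  also have "\<dots> = (1 - p K ^ n) ^ Suc K" by simp
  also have "\<dots> \<le> 1 / 2"
  proof -
    \<comment> \<open>With \<open>x = p K ^ n\<close>, the choice of \<open>K\<close> gives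
      \<open>2 \<le> 1 + (K + 1) * x\<close>, and Bernoulli's inequality bounds this by
      \<open>(1 + x) ^ (K + 1)\<close>. The product with \<open>(1 - x) ^ (K + 1)\<close> is
      \<open>(1 - x^2) ^ (K + 1)\<close>, hence at most 1.\<close>
    have "(1 - p K ^ n) ^ Suc K * 2 \<le> (1 - p K ^ n) ^ Suc K * (1 + real (Suc K) * p K ^ n)"
      using x K by (intro mult_left_mono) auto
    also have "\<dots> \<le> (1 - p K ^ n) ^ Suc K * (1 + p K ^ n) ^ Suc K"
      using x by (intro mult_left_mono Bernoulli_inequality) auto
    also have "\<dots> = (1 - (p K ^ n)\<^sup>2) ^ Suc K"
      unfolding power_mult_distrib[symmetric] by (simp add: algebra_simps power2_eq_square)
    also have "\<dots> \<le> 1"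
      using x by (intro power_le_one) (auto simp: power_le_one)
    finally show ?thesis by simp
  qed
  finally have N_le: "measure (sample n) ?N \<le> 1 / 2" .
  let ?A = "space (sample n) - ?N"
  have "1 / 2 * measure (sample n) ?A \<le> Delta n ?\<mu>"
  proof (rule Delta_ge)
    fix X assume "X \<in> ?A"
    then obtain k where "X \<in> A k" by auto
    then have "emp_mean n X k = 1" using \<open>0 < n\<close> by (auto simp: A_def emp_mean_def)
    then show "\<exists>k. 1 / 2 \<le> deviation n X k"
      using p[of k] mean[of k] by (intro exI[of _ k]) auto
  qed (use N in auto)
  moreover have "measure (sample n) ?A = 1 - measure (sample n) ?N"
    using N by (rule sample.P.prob_compl)
  ultimately show ?thesis using N_le by simp
qed

theorem theorem1:
  "(\<forall>p \<in> dec_null_seqs.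
      ((\<lambda>n. Delta n (bernoulli_product p)) \<longlonglongrightarrow> 0) \<longleftrightarrow> T_seq p < \<infinity>) \<and>
   (\<forall>\<mu> :: (nat \<Rightarrow> bool) measure.
      prob_space \<mu> \<longrightarrow> sets \<mu> = sets cube \<longrightarrow> T_meas \<mu> < \<infinity> \<longrightarrow>
      (\<lambda>n. Delta n \<mu>) \<longlonglongrightarrow> 0)"
proof (intro conjI ballI allI impI)
  fix p assume "p \<in> dec_null_seqs"
  then have p: "0 \<le> p k" "p k \<le> 1/2" and dec: "decseq p" for k
    by (auto simp: dec_null_seqs_def)
  show "((\<lambda>n. Delta n (bernoulli_product p)) \<longlonglongrightarrow> 0) \<longleftrightarrow> T_seq p < \<infinity>"
  proof
    assume lim: "(\<lambda>n. Delta n (bernoulli_product p)) \<longlonglongrightarrow> 0"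
    show "T_seq p < \<infinity>"
    proof (rule ccontr)
      assume "\<not> T_seq p < \<infinity>"
      then have "1 / 4 \<le> Delta n (bernoulli_product p)" if "1 \<le> n" for n
        using p dec that by (intro Delta_bernoulli_product_ge) auto
      then have "(1 / 4 :: real) \<le> 0"
        by (intro LIMSEQ_le_const[OF lim]) blast
      then show False by simp
    qed
  next
    assume "T_seq p < \<infinity>"
    then obtain a where a: "0 < a" "\<And>k. p k \<le> real (k + 2) powr - a"
      using T_seq_finite_decay[of p] p by blast
    interpret prob_space "bernoulli_product p" by (rule prob_space_bernoulli_product)
    interpret cube_prob "bernoulli_product p" by unfold_locales (rule sets_bernoulli_product)
    have "mean (bernoulli_product p) k = p k" for k
      using p[of k] by (intro mean_bernoulli_product) auto
    \<comment> \<open>All means are at most 1/2, so folding changes nothing and the given order of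
      the coordinates can be kept.\<close>
    then have "fold_half (mean (bernoulli_product p)) k = p k" for k
      using p[of k] by (simp add: fold_half_def)
    then show "(\<lambda>n. Delta n (bernoulli_product p)) \<longlonglongrightarrow> 0"
      using a by (intro Delta_tendsto_zero[of a id]) auto
  qed
next
  fix \<mu> :: "(nat \<Rightarrow> bool) measure"
  assume "prob_space \<mu>" and sets: "sets \<mu> = sets cube" and T: "T_meas \<mu> < \<infinity>"
  interpret prob_space \<mu> by fact
  interpret cube_prob \<mu> by unfold_locales (rule sets)
  let ?q = "fold_half (mean \<mu>)"
  have q: "0 \<le> ?q k" "?q k \<le> 1/2" for k
    using mean_bounds[of k] by (auto simp: fold_half_def min_def)
  have null: "?q \<longlonglongrightarrow> 0" and T': "T_seq (dec_rearr ?q) < \<infinity>"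
    using T by (auto simp: T_meas_def split: if_splits)
  \<comment> \<open>The greedy enumeration can miss coordinates only where the folded mean vanishes,
    as happens when infinitely many positive entries precede the zeros.\<close>
  obtain \<sigma> where \<sigma>: "dec_rearr ?q = ?q \<circ> \<sigma>" "{k. ?q k \<noteq> 0} \<subseteq> range \<sigma>"
    using dec_rearr_null(2)[of ?q, OF q(1) null] by blast
  obtain a where "0 < a" "\<And>k. dec_rearr ?q k \<le> real (k + 2) powr - a"
    using T_seq_finite_decay[of "dec_rearr ?q"] T' q \<sigma>(1) by auto
  then show "(\<lambda>n. Delta n \<mu>) \<longlonglongrightarrow> 0"
    using \<sigma> by (intro Delta_tendsto_zero[of a \<sigma>]) auto
qed

end
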